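(* Let $(X,\tau)$ be a metrizable space and let $F\subseteq X$ be finite with $|F|\ge2$. The following are equivalent: (i) $(X,\tau)$ is compact; (ii) $\mathcal L_F^m(\tau)=\{\tau\}$; (iii) every two members of $\mathcal L_F^m(\tau)$ have a common Hausdorff lower topology on $X$, i.e. for all $\sigma_1,\sigma_2\in\mathcal L_F^m(\tau)$ there is a Hausdorff topology $\lambda$ on $X$ with $\lambda\subseteq\sigma_1\cap\sigma_2$; (iv) $\mathcal L_F^m(\tau)$ is downward directed, that is, every two members have a common lower bound belonging to $\mathcal L_F^m(\tau)$; (v) $\mathcal L_F^m(\tau)$ is a lattice. When these conditions hold, $\mathcal L_F^m(\tau)$ is the one-element distributive lattice.
   Context: $\mathcal L_F^m(\tau)$ is the family of all metrizable topologies $\sigma$ on $X$ with $\sigma\subseteq\tau$ and $\sigma|_{X\setminus F}=\tau|_{X\setminus F}$ (equal subspace topologies on $X\setminus F$), partially ordered by inclusion. *)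

theory Defs
  imports "HOL-Analysis.Analysis" "HOL-Algebra.Lattice"
begin

text \<open>
  A topology on a set \<open>X\<close> is a value \<open>\<sigma> :: 'a topology\<close> with \<open>topspace \<sigma> = X\<close>.
  Inclusion \<open>\<sigma> \<subseteq> \<tau>\<close> of topologies is inclusion of their families of open sets,
  that is \<open>openin \<sigma> \<le> openin \<tau>\<close> in the pointwise order on predicates.
  The latter alone only gives \<open>topspace \<sigma> \<subseteq> topspace \<tau>\<close>, so equality of the
  underlying sets is a separate condition.
\<close>

definition metrizable_lower_topologies :: "'a set \<Rightarrow> 'a topology \<Rightarrow> 'a topology set" where
  "metrizable_lower_topologies F \<tau> =
     {\<sigma>. topspace \<sigma> = topspace \<tau> \<and> metrizable_space \<sigma> \<and> openin \<sigma> \<le> openin \<tau> \<and>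
          subtopology \<sigma> (topspace \<tau> - F) = subtopology \<tau> (topspace \<tau> - F)}"

definition metrizable_lower_order :: "'a set \<Rightarrow> 'a topology \<Rightarrow> 'a topology gorder" where
  "metrizable_lower_order F \<tau> =
     \<lparr>carrier = metrizable_lower_topologies F \<tau>, eq = (=), le = (\<lambda>\<sigma> \<rho>. openin \<sigma> \<le> openin \<rho>)\<rparr>"

definition downward_directed :: "('a, 'b) gorder_scheme \<Rightarrow> bool" where
  "downward_directed L \<longleftrightarrow>
     (\<forall>x\<in>carrier L. \<forall>y\<in>carrier L. \<exists>z\<in>carrier L. z \<sqsubseteq>\<^bsub>L\<^esub> x \<and> z \<sqsubseteq>\<^bsub>L\<^esub> y)"

definition distributive_lattice :: "('a, 'b) gorder_scheme \<Rightarrow> bool" where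
  "distributive_lattice L \<longleftrightarrow> Lattice.lattice L \<and>
     (\<forall>x\<in>carrier L. \<forall>y\<in>carrier L. \<forall>z\<in>carrier L.
        x \<sqinter>\<^bsub>L\<^esub> (y \<squnion>\<^bsub>L\<^esub> z) = (x \<sqinter>\<^bsub>L\<^esub> y) \<squnion>\<^bsub>L\<^esub> (x \<sqinter>\<^bsub>L\<^esub> z))"

end

theory Submission
  imports Defs
begin

text \<open>
  On a compact space no Hausdorff topology is strictly coarser than the given one, so
  compactness leaves \<open>\<tau>\<close> as the only member of the family, and the other conditions hold
  trivially.

  Conversely, each condition makes every two members of the family share a coarser Hausdorff
  topology, and this fails once \<open>\<tau>\<close> is not compact.  The reason is that a noncompact metrizable
  space carries an unbounded continuous real function \<open>f\<close>
  (\<open>noncompact_metrizable_unbounded_function\<close>), whose superlevel sets \<open>{x. f x > n}\<close> act as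
  neighbourhoods of a point at infinity.  For any point \<open>p\<close>, gluing infinity onto \<open>p\<close>
  gives a metrizable topology \<open>\<sigma>\<^sub>p \<subseteq> \<tau>\<close> that agrees with \<open>\<tau>\<close> off \<open>p\<close> and in which every
  neighbourhood of \<open>p\<close> contains a superlevel set of \<open>f\<close>
  (\<open>metrizable_lower_topology_pinched_at\<close>).  If \<open>p\<close> and \<open>q\<close> are distinct points of
  \<open>F\<close>, then in a topology below both \<open>\<sigma>\<^sub>p\<close> and \<open>\<sigma>\<^sub>q\<close> every neighbourhood of \<open>p\<close> and every
  neighbourhood of \<open>q\<close> contain a common superlevel set, which is nonempty because \<open>f\<close> is unbounded,
  so \<open>p\<close> and \<open>q\<close> cannot be separated.

  The gluing is done by a metric.  Given a continuous weight \<open>w \<ge> 0\<close> that vanishes only at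
  \<open>p\<close>, one lets travellers jump through \<open>p\<close> at cost \<open>w x + w y\<close>; with
  \<open>w x = min (d x p) (1 / max 1 (f x))\<close> the points where \<open>f\<close> is large are close to \<open>p\<close>.
\<close>

section \<open>Pinching a metric space at a point\<close>

text \<open>
  The summand \<open>\<bar>w x - w y\<bar>\<close> does not change the topology when \<open>w\<close> is continuous, and it
  makes \<open>w\<close> 1-Lipschitz.  The triangle inequality for the minimum needs exactly that: a direct step
  from \<open>x\<close> to \<open>y\<close> followed by a jump from \<open>y\<close> to \<open>z\<close> must cost at least a jump from \<open>x\<close> to \<open>z\<close>.
\<close>

definition pinch_dist :: "('a \<Rightarrow> 'a \<Rightarrow> real) \<Rightarrow> ('a \<Rightarrow> real) \<Rightarrow> 'a \<Rightarrow> 'a \<Rightarrow> real" where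
  "pinch_dist d w x y = min (d x y + \<bar>w x - w y\<bar>) (w x + w y)"

context Metric_space
begin

lemma Metric_space_pinch_dist:
  assumes "\<And>x. 0 \<le> w x" and w0: "\<And>x. x \<in> M \<Longrightarrow> w x = 0 \<longleftrightarrow> x = p"
  shows "Metric_space M (pinch_dist d w)"
proof
  show "0 \<le> pinch_dist d w x y" for x y
    using assms(1) by (simp add: pinch_dist_def)
  show "pinch_dist d w x y = pinch_dist d w y x" for x y
    by (simp add: pinch_dist_def commute abs_minus_commute add.commute)
  show "pinch_dist d w x y = 0 \<longleftrightarrow> x = y" if "x \<in> M" "y \<in> M" for x y
  proof
    assume 0: "pinch_dist d w x y = 0"
    have "0 \<le> d x y" "0 \<le> w x" "0 \<le> w y"
      using assms(1) by auto
    with 0 have "d x y = 0 \<or> (w x = 0 \<and> w y = 0)"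
      unfolding pinch_dist_def by linarith
    then show "x = y"
      using that w0 zero by metis
  next
    assume "x = y"
    then show "pinch_dist d w x y = 0"
      using that assms(1)[of x] by (simp add: pinch_dist_def)
  qed
  show "pinch_dist d w x z \<le> pinch_dist d w x y + pinch_dist d w y z"
    if "x \<in> M" "y \<in> M" "z \<in> M" for x y z
    using triangle[OF that] assms(1)[of x] assms(1)[of y] assms(1)[of z]
      nonneg[of x y] nonneg[of y z]
    unfolding pinch_dist_def by linarith
qed

lemma openin_pinch_imp_openin:
  assumes "Metric_space M (pinch_dist d w)" and w: "continuous_map mtopology euclideanreal w"
    and U: "openin (Metric_space.mtopology M (pinch_dist d w)) U"
  shows "openin mtopology U"
proof -
  interpret P: Metric_space M "pinch_dist d w" by fact
  show ?thesis
    unfolding openin_mtopology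
  proof (intro conjI allI impI)
    show "U \<subseteq> M"
      using U P.openin_mtopology by blast
    fix x assume "x \<in> U"
    then have "x \<in> M"
      using \<open>U \<subseteq> M\<close> by blast
    obtain e where e: "e > 0" "P.mball x e \<subseteq> U"
      using U \<open>x \<in> U\<close> P.openin_mtopology by blast
    have "openin euclideanreal (ball (w x) (e/2)) \<and> w x \<in> ball (w x) (e/2)"
      using e by auto
    then obtain r where r: "r > 0" "\<And>y. y \<in> M \<Longrightarrow> d x y < r \<Longrightarrow> w y \<in> ball (w x) (e/2)"
      using w \<open>x \<in> M\<close> unfolding continuous_map_from_metric by metis
    have "pinch_dist d w x y < e" if "y \<in> M" "d x y < min r (e/2)" for y
    proof -
      have "\<bar>w x - w y\<bar> < e/2" "d x y < e/2"
        using r(2)[of y] that by (auto simp: dist_real_def)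
      then show ?thesis
        unfolding pinch_dist_def by linarith
    qed
    then have "mball x (min r (e/2)) \<subseteq> U"
      using e(2) \<open>x \<in> M\<close> by (auto simp: subset_iff)
    then show "\<exists>r>0. mball x r \<subseteq> U"
      using r(1) e(1) by (intro exI[of _ "min r (e/2)"]) auto
  qed
qed

text \<open>Within distance \<open>w x\<close> of \<open>x\<close>, a jump through \<open>p\<close> is too expensive, so nothing changes
  near a point other than \<open>p\<close>.\<close>

lemma openin_imp_openin_pinch:
  assumes "Metric_space M (pinch_dist d w)"
    and "\<And>x. 0 \<le> w x" and "\<And>x. x \<in> M \<Longrightarrow> w x = 0 \<longleftrightarrow> x = p"
    and U: "openin mtopology U" "p \<notin> U"
  shows "openin (Metric_space.mtopology M (pinch_dist d w)) U"
proof -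
  interpret P: Metric_space M "pinch_dist d w" by fact
  show ?thesis
    unfolding P.openin_mtopology
  proof (intro conjI allI impI)
    show "U \<subseteq> M"
      using U openin_mtopology by blast
    fix x assume "x \<in> U"
    then have "x \<in> M" "x \<noteq> p"
      using U \<open>U \<subseteq> M\<close> by auto
    then have "w x > 0"
      using assms(2)[of x] assms(3)[of x] by simp
    obtain e where e: "e > 0" "mball x e \<subseteq> U"
      using U \<open>x \<in> U\<close> openin_mtopology by blast
    have "d x y < e" if "pinch_dist d w x y < min e (w x)" for y
      using that assms(2)[of y] by (auto simp: pinch_dist_def)
    then have "P.mball x (min e (w x)) \<subseteq> U"
      using e(2) by (auto simp: subset_iff)
    then show "\<exists>r>0. P.mball x r \<subseteq> U"
      using e(1) \<open>w x > 0\<close> by (intro exI[of _ "min e (w x)"]) auto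
  qed
qed

lemma openin_pinch_contains_sublevel:
  assumes "Metric_space M (pinch_dist d w)" and "w p = 0"
    and "openin (Metric_space.mtopology M (pinch_dist d w)) U" "p \<in> U"
  obtains e where "e > 0" "\<And>x. x \<in> M \<Longrightarrow> w x < e \<Longrightarrow> x \<in> U"
proof -
  interpret P: Metric_space M "pinch_dist d w" by fact
  obtain e where e: "e > 0" "P.mball p e \<subseteq> U"
    using assms(3,4) P.openin_mtopology by blast
  have "x \<in> U" if "x \<in> M" "w x < e" for x
  proof -
    have "pinch_dist d w p x < e"
      using that(2) \<open>w p = 0\<close> by (auto simp: pinch_dist_def)
    moreover have "p \<in> M"
      using assms(3,4) P.openin_mtopology by blast
    ultimately show ?thesis
      using e(2) that(1) by (auto simp: subset_iff)
  qed
  with e(1) show ?thesis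
    using that by blast
qed

end

section \<open>Noncompact spaces\<close>

text \<open>By the Bolzano-Weierstrass property there is a sequence of distinct points without
  accumulation points; its range is closed and discrete, so the index function on it is
  continuous and extends by Tietze's theorem.\<close>

lemma noncompact_metrizable_unbounded_function:
  assumes "metrizable_space X" "\<not> compact_space X"
  obtains f where "continuous_map X euclideanreal f" "\<And>c. \<exists>x\<in>topspace X. f x > c"
proof -
  obtain M d where "Metric_space M d" and X: "X = Metric_space.mtopology M d"
    using assms(1) unfolding metrizable_space_def by blast
  then interpret Metric_space M d by simp
  obtain S where S: "S \<subseteq> M" "infinite S" "X derived_set_of S = {}"
    using assms(2) unfolding X compact_space_eq_Bolzano_Weierstrass by blast
  obtain s :: "nat \<Rightarrow> 'a" where s: "inj s" "range s \<subseteq> S"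
    using infinite_countable_subset[OF S(2)] by blast
  have sM: "range s \<subseteq> topspace X"
    using s(2) S(1) by (simp add: X)
  have der: "X derived_set_of range s = {}"
    using derived_set_of_mono[OF s(2), of X] S(3) by simp
  have clo: "closedin X (range s)"
    using sM der by (simp add: closedin_contains_derived_set)
  have disc: "subtopology X (range s) = discrete_topology (range s)"
    using sM der by (simp add: subtopology_eq_discrete_topology_eq)
  obtain f where f: "continuous_map X euclideanreal f"
      "\<And>x. x \<in> range s \<Longrightarrow> f x = real (inv s x)"
  proof (rule Tietze_extension_realinterval)
    show "normal_space X"
      using assms(1) by (rule metrizable_imp_normal_space)
    show "continuous_map (subtopology X (range s)) euclideanreal (\<lambda>x. real (inv s x))"
      unfolding disc by simp
  qed (use clo in auto)
  have "\<exists>x\<in>topspace X. f x > c" for c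
  proof -
    obtain n where "real n > c"
      using reals_Archimedean2 by blast
    then have "f (s n) > c"
      using f(2)[of "s n"] s(1) by simp
    then show ?thesis
      using sM by blast
  qed
  with f(1) show ?thesis
    using that by blast
qed

lemma metrizable_lower_topology_pinched_at:
  assumes "metrizable_space \<tau>" and "p \<in> F" "p \<in> topspace \<tau>"
    and f: "continuous_map \<tau> euclideanreal f"
  obtains \<sigma> where "\<sigma> \<in> metrizable_lower_topologies F \<tau>"
    "\<And>U. openin \<sigma> U \<Longrightarrow> p \<in> U \<Longrightarrow> \<exists>c. \<forall>x\<in>topspace \<tau>. f x > c \<longrightarrow> x \<in> U"
proof -
  obtain M d where "Metric_space M d" and \<tau>: "\<tau> = Metric_space.mtopology M d"
    using assms(1) unfolding metrizable_space_def by blast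
  then interpret Metric_space M d by simp
  have p: "p \<in> M"
    using assms(3) by (simp add: \<tau>)
  \<comment> \<open>Cutting \<open>f\<close> off below at 1 keeps the weight positive where \<open>f \<le> 0\<close>.\<close>
  define w where "w = (\<lambda>x. min (d x p) (1 / max 1 (f x)))"
  have w_nonneg: "0 \<le> w x" for x
    by (simp add: w_def)
  have w0: "w x = 0 \<longleftrightarrow> x = p" if "x \<in> M" for x
  proof -
    have "1 / max 1 (f x) > 0" by simp
    then show ?thesis
      using that p nonneg[of x p] zero[of x p] unfolding w_def by linarith
  qed
  have dist_cont: "continuous_map mtopology euclideanreal (\<lambda>x. d x p)"
    using continuous_map_mdist[of mtopology "metric (M,d)" "\<lambda>x. x" "\<lambda>x. p"] p
    by (simp add: mtopology_of)
  have w_cont: "continuous_map mtopology euclideanreal w"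
    unfolding w_def using f dist_cont
    by (intro continuous_map_real_min continuous_map_real_divide continuous_map_real_max)
       (auto simp: \<tau>)
  note P_met = Metric_space_pinch_dist[of w, OF w_nonneg w0]
  interpret P: Metric_space M "pinch_dist d w"
    by (rule P_met)
  have below: "openin P.mtopology U \<Longrightarrow> openin \<tau> U" for U
    unfolding \<tau> using openin_pinch_imp_openin[OF P_met w_cont] .
  have off_p: "openin \<tau> U \<Longrightarrow> p \<notin> U \<Longrightarrow> openin P.mtopology U" for U
    unfolding \<tau> using openin_imp_openin_pinch[OF P_met w_nonneg w0] .
  have "subtopology P.mtopology (M - F) = subtopology \<tau> (M - F)"
    unfolding topology_eq openin_subtopology
  proof (intro allI iffI)
    fix S assume "\<exists>T. openin \<tau> T \<and> S = T \<inter> (M - F)"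
    then obtain T where T: "openin \<tau> T" "S = T \<inter> (M - F)"
      by blast
    have "openin \<tau> (T - {p})"
      using T(1) closedin_Hausdorff_singleton[of \<tau> p] metrizable_imp_Hausdorff_space assms(1,3)
      by (intro openin_diff) auto
    then have "openin P.mtopology (T - {p})"
      by (rule off_p) simp
    moreover have "S = (T - {p}) \<inter> (M - F)"
      using T(2) assms(2) by blast
    ultimately show "\<exists>T. openin P.mtopology T \<and> S = T \<inter> (M - F)"
      by blast
  qed (use below in blast)
  then have "P.mtopology \<in> metrizable_lower_topologies F \<tau>"
    using below P.metrizable_space_mtopology
    by (auto simp: metrizable_lower_topologies_def \<tau>)
  moreover have "\<exists>c. \<forall>x\<in>topspace \<tau>. f x > c \<longrightarrow> x \<in> U"
    if U: "openin P.mtopology U" "p \<in> U" for U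
  proof -
    obtain e where e: "e > 0" "\<And>x. x \<in> M \<Longrightarrow> w x < e \<Longrightarrow> x \<in> U"
      using openin_pinch_contains_sublevel[OF P_met _ U] w0[OF p] by blast
    have "w x < e" if "f x > 1 / e" for x
    proof -
      have "0 < f x"
        using that e(1) by (meson divide_pos_pos less_trans zero_less_one)
      have "w x \<le> 1 / max 1 (f x)"
        by (simp add: w_def)
      also have "\<dots> \<le> 1 / f x"
        using \<open>0 < f x\<close> by (intro divide_left_mono) auto
      also have "\<dots> < e"
        using that \<open>0 < f x\<close> e(1) by (simp add: field_simps)
      finally show ?thesis .
    qed
    then show ?thesis
      using e(2) by (auto simp: \<tau>)
  qed
  ultimately show ?thesis
    using that by blast
qed

lemma noncompact_no_common_Hausdorff_lower_topology:
  assumes "metrizable_space \<tau>" "\<not> compact_space \<tau>"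
    and "F \<subseteq> topspace \<tau>" and "p \<in> F" "q \<in> F" "p \<noteq> q"
  obtains \<sigma>\<^sub>1 \<sigma>\<^sub>2 where "\<sigma>\<^sub>1 \<in> metrizable_lower_topologies F \<tau>"
    "\<sigma>\<^sub>2 \<in> metrizable_lower_topologies F \<tau>"
    "\<And>\<rho>. topspace \<rho> = topspace \<tau> \<Longrightarrow> Hausdorff_space \<rho> \<Longrightarrow>
       openin \<rho> \<le> openin \<sigma>\<^sub>1 \<Longrightarrow> openin \<rho> \<le> openin \<sigma>\<^sub>2 \<Longrightarrow> False"
proof -
  obtain f where f: "continuous_map \<tau> euclideanreal f" "\<And>c. \<exists>x\<in>topspace \<tau>. f x > c"
    using noncompact_metrizable_unbounded_function[OF assms(1,2)] by blast
  have pq: "p \<in> topspace \<tau>" "q \<in> topspace \<tau>"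
    using assms by auto
  obtain \<sigma>\<^sub>1 where \<sigma>1: "\<sigma>\<^sub>1 \<in> metrizable_lower_topologies F \<tau>"
    "\<And>U. openin \<sigma>\<^sub>1 U \<Longrightarrow> p \<in> U \<Longrightarrow> \<exists>c. \<forall>x\<in>topspace \<tau>. f x > c \<longrightarrow> x \<in> U"
    using metrizable_lower_topology_pinched_at[OF assms(1,4) pq(1) f(1)] by blast
  obtain \<sigma>\<^sub>2 where \<sigma>2: "\<sigma>\<^sub>2 \<in> metrizable_lower_topologies F \<tau>"
    "\<And>U. openin \<sigma>\<^sub>2 U \<Longrightarrow> q \<in> U \<Longrightarrow> \<exists>c. \<forall>x\<in>topspace \<tau>. f x > c \<longrightarrow> x \<in> U"
    using metrizable_lower_topology_pinched_at[OF assms(1,5) pq(2) f(1)] by blast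
  have False if \<rho>: "topspace \<rho> = topspace \<tau>" "Hausdorff_space \<rho>"
      "openin \<rho> \<le> openin \<sigma>\<^sub>1" "openin \<rho> \<le> openin \<sigma>\<^sub>2" for \<rho>
  proof -
    obtain U V where UV: "openin \<rho> U" "openin \<rho> V" "p \<in> U" "q \<in> V" "disjnt U V"
      using \<rho>(1,2) pq \<open>p \<noteq> q\<close> unfolding Hausdorff_space_def by metis
    have "openin \<sigma>\<^sub>1 U" "openin \<sigma>\<^sub>2 V"
      using UV \<rho>(3,4) by (auto simp: le_fun_def)
    obtain a where a: "\<And>x. x \<in> topspace \<tau> \<Longrightarrow> f x > a \<Longrightarrow> x \<in> U"
      using \<sigma>1(2)[OF \<open>openin \<sigma>\<^sub>1 U\<close> \<open>p \<in> U\<close>] by blast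
    obtain b where b: "\<And>x. x \<in> topspace \<tau> \<Longrightarrow> f x > b \<Longrightarrow> x \<in> V"
      using \<sigma>2(2)[OF \<open>openin \<sigma>\<^sub>2 V\<close> \<open>q \<in> V\<close>] by blast
    obtain x where "x \<in> topspace \<tau>" "f x > max a b"
      using f(2) by blast
    then have "x \<in> U" "x \<in> V"
      using a b by auto
    then show False
      using UV(5) by (auto simp: disjnt_def)
  qed
  then show ?thesis
    using that \<sigma>1(1) \<sigma>2(1) by blast
qed

section \<open>Compact spaces\<close>

lemma compact_space_Hausdorff_lower_topology_eq:
  assumes "compact_space \<tau>" "Hausdorff_space \<sigma>"
    and "topspace \<sigma> = topspace \<tau>" "openin \<sigma> \<le> openin \<tau>"
  shows "\<sigma> = \<tau>"
proof -
  have cont: "continuous_map \<tau> \<sigma> id"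
    using assms(3,4) by (auto simp: topology_finer_continuous_id le_fun_def)
  have "openin \<sigma> U" if "openin \<tau> U" for U
  proof -
    have "compactin \<tau> (topspace \<tau> - U)"
      using that assms(1) by (intro closedin_compact_space) auto
    then have "compactin \<sigma> (topspace \<tau> - U)"
      using image_compactin[OF _ cont] by simp
    then have "closedin \<sigma> (topspace \<sigma> - U)"
      using assms(2,3) by (simp add: compactin_imp_closedin)
    then show ?thesis
      using openin_subset[OF that] assms(3) by (simp add: openin_closedin_eq)
  qed
  then show ?thesis
    using assms(4) by (auto simp: topology_eq le_fun_def)
qed

lemma metrizable_lower_topologies_compact:
  assumes "metrizable_space \<tau>" "compact_space \<tau>"
  shows "metrizable_lower_topologies F \<tau> = {\<tau>}"
  using assms compact_space_Hausdorff_lower_topology_eq[OF assms(2)]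
  by (auto simp: metrizable_lower_topologies_def metrizable_imp_Hausdorff_space)

section \<open>The order on the family\<close>

lemma distributive_lattice_singleton:
  assumes "carrier L = {x}" "eq L = (=)" "le L x x"
  shows "distributive_lattice L"
proof -
  interpret Lattice.lattice L
    by unfold_locales (use assms in \<open>auto simp: least_def greatest_def Upper_def Lower_def\<close>)
  have "x \<sqinter>\<^bsub>L\<^esub> x = x" "x \<squnion>\<^bsub>L\<^esub> x = x"
    using meet_closed[of x x] join_closed[of x x] by (simp_all add: assms(1))
  then show ?thesis
    unfolding distributive_lattice_def using lattice_axioms by (simp add: assms(1))
qed

lemma lattice_imp_downward_directed:
  assumes "Lattice.lattice L"
  shows "downward_directed L"
proof -
  interpret Lattice.lattice L by fact
  show ?thesis
    unfolding downward_directed_def using meet_closed meet_left meet_right by blast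
qed

theorem corollary6p5:
  fixes \<tau> :: "'a topology" and F :: "'a set"
  assumes "metrizable_space \<tau>"
    and "F \<subseteq> topspace \<tau>" and "finite F" and "card F \<ge> 2"
  shows "(compact_space \<tau> \<longleftrightarrow> metrizable_lower_topologies F \<tau> = {\<tau>}) \<and>
    (compact_space \<tau> \<longleftrightarrow>
       (\<forall>\<sigma>\<^sub>1 \<in> metrizable_lower_topologies F \<tau>. \<forall>\<sigma>\<^sub>2 \<in> metrizable_lower_topologies F \<tau>.
          \<exists>\<rho> :: 'a topology. topspace \<rho> = topspace \<tau> \<and> Hausdorff_space \<rho> \<and>
            openin \<rho> \<le> openin \<sigma>\<^sub>1 \<and> openin \<rho> \<le> openin \<sigma>\<^sub>2)) \<and>
    (compact_space \<tau> \<longleftrightarrow> downward_directed (metrizable_lower_order F \<tau>)) \<and>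
    (compact_space \<tau> \<longleftrightarrow> Lattice.lattice (metrizable_lower_order F \<tau>)) \<and>
    (compact_space \<tau> \<longrightarrow>
       card (carrier (metrizable_lower_order F \<tau>)) = 1 \<and>
       distributive_lattice (metrizable_lower_order F \<tau>))"
proof -
  let ?L = "metrizable_lower_order F \<tau>"
  let ?common_lower = "\<forall>\<sigma>\<^sub>1 \<in> metrizable_lower_topologies F \<tau>.
    \<forall>\<sigma>\<^sub>2 \<in> metrizable_lower_topologies F \<tau>.
      \<exists>\<rho> :: 'a topology. topspace \<rho> = topspace \<tau> \<and> Hausdorff_space \<rho> \<and>
        openin \<rho> \<le> openin \<sigma>\<^sub>1 \<and> openin \<rho> \<le> openin \<sigma>\<^sub>2"
  have singleton: "metrizable_lower_topologies F \<tau> = {\<tau>}" if "compact_space \<tau>"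
    using metrizable_lower_topologies_compact[OF assms(1) that] .
  have distrib: "distributive_lattice ?L" if "metrizable_lower_topologies F \<tau> = {\<tau>}"
    by (rule distributive_lattice_singleton[of _ \<tau>])
       (use that in \<open>auto simp: metrizable_lower_order_def\<close>)
  have lattice: "Lattice.lattice ?L" if "metrizable_lower_topologies F \<tau> = {\<tau>}"
    using distrib[OF that] by (simp add: distributive_lattice_def)
  have directed: "downward_directed ?L" if "Lattice.lattice ?L"
    using lattice_imp_downward_directed[OF that] .
  have common_lower: ?common_lower if "downward_directed ?L"
  proof (intro ballI)
    fix \<sigma>\<^sub>1 \<sigma>\<^sub>2
    assume "\<sigma>\<^sub>1 \<in> metrizable_lower_topologies F \<tau>" "\<sigma>\<^sub>2 \<in> metrizable_lower_topologies F \<tau>"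
    with that obtain \<rho> where "\<rho> \<in> metrizable_lower_topologies F \<tau>"
      "openin \<rho> \<le> openin \<sigma>\<^sub>1" "openin \<rho> \<le> openin \<sigma>\<^sub>2"
      by (auto simp: downward_directed_def metrizable_lower_order_def)
    then show "\<exists>\<rho> :: 'a topology. topspace \<rho> = topspace \<tau> \<and> Hausdorff_space \<rho> \<and>
        openin \<rho> \<le> openin \<sigma>\<^sub>1 \<and> openin \<rho> \<le> openin \<sigma>\<^sub>2"
      by (auto simp: metrizable_lower_topologies_def intro: metrizable_imp_Hausdorff_space)
  qed
  have compact: "compact_space \<tau>" if ?common_lower
  proof (rule ccontr)
    assume nc: "\<not> compact_space \<tau>"
    obtain p q where pq: "p \<in> F" "q \<in> F" "p \<noteq> q"
      using assms(3,4) card_le_Suc0_iff_eq[OF assms(3)] by auto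
    show False
      using noncompact_no_common_Hausdorff_lower_topology[OF assms(1) nc assms(2) pq] that
      by metis
  qed
  have "card (carrier ?L) = 1" if "compact_space \<tau>"
    using singleton[OF that] by (simp add: metrizable_lower_order_def)
  with singleton distrib lattice directed common_lower compact show ?thesis
    by blast
qed

end
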